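(* Suppose that the Foster--Lyapunov drift condition (Condition 1 of the context) holds. For each $n\in\mathbb{Z}_+$, the probability vector $\alpha_n^*=(\alpha_n^*(j))_{j\in\mathbb{M}_n}$ given by $$\alpha_n^*(j)=\begin{cases}1,&j=j_n^*,\\0,&j\ne j_n^*,\end{cases}\qquad j_n^*\in\operatorname*{arg\,min}_{j\in\mathbb{M}_n}\frac{y_n(j)}{u_n^*(j)},$$ is an optimal solution of the linear fractional programming problem $$\text{minimize } r_n(\alpha_n):=\frac{\alpha_ny_n}{\alpha_nu_n^*}\quad\text{subject to }\alpha_n\ge0,\ \alpha_ne=1,$$ over row vectors $\alpha_n$ indexed by $\mathbb{M}_n$.
   Context: Notation: $\mathbb{N}=\{1,2,\dots\}$, $\mathbb{Z}_+=\{0,1,2,\dots\}$, $\mathbb{Z}_n=\{0,1,\dots,n\}$. For each $k\in\mathbb{Z}_+$ let $M_k\in\mathbb{N}$, $\mathbb{M}_k=\{1,\dots,M_k\}$, $\mathbb{L}_k=\{k\}\times\mathbb{M}_k$, $\mathbb{S}=\bigcup_{k\ge0}\mathbb{L}_k$, $\mathbb{S}_n=\bigcup_{k=0}^n\mathbb{L}_k$. $e$ is the column vector of ones of appropriate size. Standing assumptions: $Q$ is the stable, conservative ($Qe=0$) generator of a regular-jump (non-explosive) continuous-time Markov chain on $\mathbb{S}$; it is ergodic (irreducible and positive recurrent) and upper block-Hessenberg: writing $Q_{k,\ell}$ for the $\mathbb{L}_k\times\mathbb{L}_\ell$ block, $Q_{k,\ell}=O$ whenever $\ell<k-1$. Truncation: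 ${}_{(n)}Q$ is the restriction of $Q$ to $\mathbb{S}_n\times\mathbb{S}_n$; the inverse $(-{}_{(n)}Q)^{-1}$ exists, and its $\mathbb{L}_k\times\mathbb{L}_\ell$ block is denoted ${}_{(n)}X_{k,\ell}$. Matrices: $U_n^*={}_{(n)}X_{n,n}$; $U_{n,k}=Q_{n,n-1}\,{}_{(n-1)}X_{n-1,k}$ for $0\le k\le n-1$ and $U_{n,n}=I$; $U_{n,k}^*=U_n^*U_{n,k}$ for $k\in\mathbb{Z}_n$; $u_n^*=(u_n^*(j))_{j\in\mathbb{M}_n}=\sum_{\ell=0}^nU_{n,\ell}^*e$ (one has $u_n^*>0$). Condition 1: $Q$ is irreducible, and there exist a constant $b\in(0,\infty)$, a finite set $\mathbb{C}\subset\mathbb{S}$ and a positive column vector $v=(v(k,i))_{(k,i)\in\mathbb{S}}$ with $\inf_{(k,i)\in\mathbb{S}}v(k,i)>0$ and $Qv\le -e+b\,1_{\mathbb{C}}$, where $1_{\mathbb{C}}$ is the column vector with entries $1$ on $\mathbb{C}$ and $0$ on $\mathbb{S}\setminus\mathbb{C}$. Write $v_n=(v(n,i))_{i\in\mathbb{M}_n}$. Define $y_n=(y_n(j))_{j\in\mathbb{M}_n}=v_n+\sum_{k=0}^nU_{n,k}^*\sum_{\ell=n+1}^\infty Q_{k,\ell}v_\ell$ (one has $y_n>0$). *)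

theory Defs
  imports "HOL-Probability.Probability"
begin

type_synonym state = "nat \<times> nat"

definition level :: "(nat \<Rightarrow> nat) \<Rightarrow> nat \<Rightarrow> state set"
  where "level M k = {k} \<times> {1..M k}"

definition states :: "(nat \<Rightarrow> nat) \<Rightarrow> state set"
  where "states M = (\<Union>k. level M k)"

definition states_upto :: "(nat \<Rightarrow> nat) \<Rightarrow> nat \<Rightarrow> state set"
  where "states_upto M n = (\<Union>k\<le>n. level M k)"

text \<open>
  Matrices indexed by the state space are functions of two states; only the entries with both
  indices in the state space matter. Stability (finite diagonal entries) is built into the type
  \<^typ>\<open>real\<close>.
\<close>

definition conservative_generator :: "state set \<Rightarrow> (state \<Rightarrow> state \<Rightarrow> real) \<Rightarrow> bool"
  where "conservative_generator S Q \<longleftrightarrow>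
    (\<forall>x\<in>S. \<forall>y\<in>S. x \<noteq> y \<longrightarrow> Q x y \<ge> 0) \<and>
    (\<forall>x\<in>S. ((\<lambda>y. Q x y) has_sum 0) S)"

definition irreducible_generator :: "state set \<Rightarrow> (state \<Rightarrow> state \<Rightarrow> real) \<Rightarrow> bool"
  where "irreducible_generator S Q \<longleftrightarrow>
    (\<forall>x\<in>S. \<forall>y\<in>S. (x, y) \<in> {(a, b). a \<in> S \<and> b \<in> S \<and> a \<noteq> b \<and> Q a b > 0}\<^sup>*)"

definition upper_block_Hessenberg :: "(nat \<Rightarrow> nat) \<Rightarrow> (state \<Rightarrow> state \<Rightarrow> real) \<Rightarrow> bool"
  where "upper_block_Hessenberg M Q \<longleftrightarrow>
    (\<forall>k l. l + 1 < k \<longrightarrow> (\<forall>x\<in>level M k. \<forall>y\<in>level M l. Q x y = 0))"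

text \<open>
  A chain is a process \<open>X\<close> with time set \<open>[0, \<infinity>)\<close>, together with a family of laws \<open>P x\<close>, one for
  each initial state \<open>x\<close>. The behaviour of \<open>X\<close> at negative times is irrelevant.
\<close>

definition trans_prob ::
    "(state \<Rightarrow> 'w measure) \<Rightarrow> (real \<Rightarrow> 'w \<Rightarrow> state) \<Rightarrow> real \<Rightarrow> state \<Rightarrow> state \<Rightarrow> real"
  where "trans_prob P X t x y = measure (P x) {\<omega> \<in> space (P x). X t \<omega> = y}"

text \<open>
  The homogeneous Markov property is stated through the finite-dimensional distributions. The
  case \<open>n = 0\<close> says that the chain starts in \<open>x\<close> almost surely under \<open>P x\<close>.
\<close>

definition markov_chain ::
    "state set \<Rightarrow> (state \<Rightarrow> 'w measure) \<Rightarrow> (real \<Rightarrow> 'w \<Rightarrow> state) \<Rightarrow> bool"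
  where "markov_chain S P X \<longleftrightarrow>
    (\<forall>x\<in>S. prob_space (P x) \<and> (\<forall>t\<ge>0. X t \<in> measurable (P x) (count_space S))) \<and>
    (\<forall>n (t :: nat \<Rightarrow> real) s.
       t 0 = 0 \<and> (\<forall>i<n. t i \<le> t (Suc i)) \<and> (\<forall>i\<le>n. s i \<in> S) \<longrightarrow>
       measure (P (s 0)) {\<omega> \<in> space (P (s 0)). \<forall>i\<le>n. X (t i) \<omega> = s i} =
       (\<Prod>i<n. trans_prob P X (t (Suc i) - t i) (s i) (s (Suc i))))"

text \<open>
  A path is a regular jump path if it is right-continuous for the discrete topology and has only
  finitely many jumps in each bounded time interval (no explosion).
\<close>

definition regular_jump_path :: "(real \<Rightarrow> 'a) \<Rightarrow> bool"
  where "regular_jump_path f \<longleftrightarrow>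
    (\<forall>t\<ge>0. eventually (\<lambda>s. f s = f t) (at_right t)) \<and>
    (\<forall>T. finite {t \<in> {0<..T}. \<not> eventually (\<lambda>s. f s = f t) (at_left t)})"

definition regular_jump_chain ::
    "state set \<Rightarrow> (state \<Rightarrow> 'w measure) \<Rightarrow> (real \<Rightarrow> 'w \<Rightarrow> state) \<Rightarrow> bool"
  where "regular_jump_chain S P X \<longleftrightarrow>
    markov_chain S P X \<and> (\<forall>x\<in>S. AE \<omega> in P x. regular_jump_path (\<lambda>t. X t \<omega>))"

definition generator_of ::
    "state set \<Rightarrow> (state \<Rightarrow> state \<Rightarrow> real) \<Rightarrow> (state \<Rightarrow> 'w measure) \<Rightarrow>
     (real \<Rightarrow> 'w \<Rightarrow> state) \<Rightarrow> bool"
  where "generator_of S Q P X \<longleftrightarrow>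
    (\<forall>x\<in>S. \<forall>y\<in>S.
       ((\<lambda>t. trans_prob P X t x y) has_real_derivative Q x y) (at 0 within {0..}))"

text \<open>The first time the path is in \<open>x\<close> after having left \<open>x\<close>; infinite if this never happens.\<close>

definition return_time :: "(real \<Rightarrow> 'w \<Rightarrow> state) \<Rightarrow> state \<Rightarrow> 'w \<Rightarrow> ennreal"
  where "return_time X x \<omega> =
    Inf {ennreal t | t. 0 < t \<and> X t \<omega> = x \<and> (\<exists>s\<in>{0<..<t}. X s \<omega> \<noteq> x)}"

definition positive_recurrent ::
    "state set \<Rightarrow> (state \<Rightarrow> 'w measure) \<Rightarrow> (real \<Rightarrow> 'w \<Rightarrow> state) \<Rightarrow> bool"
  where "positive_recurrent S P X \<longleftrightarrow> (\<forall>x\<in>S. (\<integral>\<^sup>+ \<omega>. return_time X x \<omega> \<partial>P x) < \<infinity>)"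

definition ergodic_chain ::
    "state set \<Rightarrow> (state \<Rightarrow> state \<Rightarrow> real) \<Rightarrow> (state \<Rightarrow> 'w measure) \<Rightarrow>
     (real \<Rightarrow> 'w \<Rightarrow> state) \<Rightarrow> bool"
  where "ergodic_chain S Q P X \<longleftrightarrow> irreducible_generator S Q \<and> positive_recurrent S P X"

text \<open>
  Since \<open>v\<close> is positive and only the diagonal entries of \<open>Q\<close> can be negative, \<open>Q v\<close> always makes
  sense in \<open>(-\<infinity>, \<infinity>]\<close>, and the drift inequality forces it to be finite. As \<^const>\<open>infsum\<close> is 0 for
  divergent sums, this finiteness is spelled out as summability.
\<close>

definition drift_condition ::
    "state set \<Rightarrow> (state \<Rightarrow> state \<Rightarrow> real) \<Rightarrow> real \<Rightarrow> state set \<Rightarrow> (state \<Rightarrow> real) \<Rightarrow> bool"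
  where "drift_condition S Q b C v \<longleftrightarrow>
    irreducible_generator S Q \<and> b > 0 \<and> finite C \<and> C \<subseteq> S \<and>
    (\<forall>x\<in>S. v x > 0) \<and> (INF x\<in>S. v x) > 0 \<and>
    (\<forall>x\<in>S. (\<lambda>y. Q x y * v y) summable_on S \<and>
            (\<Sum>\<^sub>\<infinity>y\<in>S. Q x y * v y) \<le> - 1 + b * indicator C x)"

text \<open>
  The inverse of a matrix with a finite index set \<open>I\<close>; entries outside \<open>I \<times> I\<close> are set to 0 so
  that it is unique whenever it exists.
\<close>

definition inverse_on :: "'i set \<Rightarrow> ('i \<Rightarrow> 'i \<Rightarrow> real) \<Rightarrow> 'i \<Rightarrow> 'i \<Rightarrow> real"
  where "inverse_on I A = (THE B.
    (\<forall>x\<in>I. \<forall>y\<in>I. (\<Sum>z\<in>I. A x z * B z y) = of_bool (x = y)) \<and>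
    (\<forall>x\<in>I. \<forall>y\<in>I. (\<Sum>z\<in>I. B x z * A z y) = of_bool (x = y)) \<and>
    (\<forall>x y. x \<notin> I \<or> y \<notin> I \<longrightarrow> B x y = 0))"

text \<open>
  The entry of \<open>trunc_X M Q n\<close> at \<open>(k, i)\<close>, \<open>(l, j)\<close> is entry \<open>(i, j)\<close> of its block \<open>(k, l)\<close>.
\<close>

definition trunc_X ::
    "(nat \<Rightarrow> nat) \<Rightarrow> (state \<Rightarrow> state \<Rightarrow> real) \<Rightarrow> nat \<Rightarrow> state \<Rightarrow> state \<Rightarrow> real"
  where "trunc_X M Q n = inverse_on (states_upto M n) (\<lambda>x y. - Q x y)"

text \<open>
  \<open>U_diag_star\<close>, \<open>U\<close>, \<open>U_star\<close> and \<open>u_star\<close> are $U_n^*$, $U_{n,k}$, $U_{n,k}^*$ and $u_n^*$; the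
  last two arguments (the last one for vectors) are the indices of the entry.
\<close>

definition U_diag_star ::
    "(nat \<Rightarrow> nat) \<Rightarrow> (state \<Rightarrow> state \<Rightarrow> real) \<Rightarrow> nat \<Rightarrow> nat \<Rightarrow> nat \<Rightarrow> real"
  where "U_diag_star M Q n i j = trunc_X M Q n (n, i) (n, j)"

definition U ::
    "(nat \<Rightarrow> nat) \<Rightarrow> (state \<Rightarrow> state \<Rightarrow> real) \<Rightarrow> nat \<Rightarrow> nat \<Rightarrow> nat \<Rightarrow> nat \<Rightarrow> real"
  where "U M Q n k i j =
    (if k = n then of_bool (i = j)
     else \<Sum>m\<in>{1..M (n - 1)}. Q (n, i) (n - 1, m) * trunc_X M Q (n - 1) (n - 1, m) (k, j))"

definition U_star ::
    "(nat \<Rightarrow> nat) \<Rightarrow> (state \<Rightarrow> state \<Rightarrow> real) \<Rightarrow> nat \<Rightarrow> nat \<Rightarrow> nat \<Rightarrow> nat \<Rightarrow> real"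
  where "U_star M Q n k i j = (\<Sum>m\<in>{1..M n}. U_diag_star M Q n i m * U M Q n k m j)"

definition u_star :: "(nat \<Rightarrow> nat) \<Rightarrow> (state \<Rightarrow> state \<Rightarrow> real) \<Rightarrow> nat \<Rightarrow> nat \<Rightarrow> real"
  where "u_star M Q n j = (\<Sum>l\<le>n. \<Sum>m\<in>{1..M l}. U_star M Q n l j m)"

definition y_vec ::
    "(nat \<Rightarrow> nat) \<Rightarrow> (state \<Rightarrow> state \<Rightarrow> real) \<Rightarrow> (state \<Rightarrow> real) \<Rightarrow> nat \<Rightarrow> nat \<Rightarrow> real"
  where "y_vec M Q v n j = v (n, j) +
    (\<Sum>k\<le>n. \<Sum>i\<in>{1..M k}. U_star M Q n k j i *
       (\<Sum>\<^sub>\<infinity>l\<in>{n + 1..}. \<Sum>m\<in>{1..M l}. Q (k, i) (l, m) * v (l, m)))"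

text \<open>
  Row vectors indexed by \<open>{1..M n}\<close> are functions on \<^typ>\<open>nat\<close>; entries outside \<open>{1..M n}\<close> affect
  neither feasibility nor the objective.
\<close>

definition prob_vector :: "(nat \<Rightarrow> nat) \<Rightarrow> nat \<Rightarrow> (nat \<Rightarrow> real) \<Rightarrow> bool"
  where "prob_vector M n \<alpha> \<longleftrightarrow> (\<forall>j\<in>{1..M n}. \<alpha> j \<ge> 0) \<and> (\<Sum>j\<in>{1..M n}. \<alpha> j) = 1"

definition r_obj ::
    "(nat \<Rightarrow> nat) \<Rightarrow> (state \<Rightarrow> state \<Rightarrow> real) \<Rightarrow> (state \<Rightarrow> real) \<Rightarrow> nat \<Rightarrow> (nat \<Rightarrow> real) \<Rightarrow> real"
  where "r_obj M Q v n \<alpha> =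
    (\<Sum>j\<in>{1..M n}. \<alpha> j * y_vec M Q v n j) / (\<Sum>j\<in>{1..M n}. \<alpha> j * u_star M Q n j)"

end

theory Submission
  imports Defs
begin

text \<open>
  A ratio \<open>\<alpha> y / \<alpha> u\<close> with \<open>u > 0\<close> is a weighted average of the ratios \<open>y j / u j\<close>, with weights
  \<open>\<alpha> j * u j / \<alpha> u\<close>. It is therefore at least the smallest of them, and a point mass at an index
  that minimises \<open>y j / u j\<close> attains this bound. Apart from this mediant inequality
  (\<open>point_mass_minimises_ratio\<close>), the content of the theorem is the positivity of
  $u_n^*$ (\<open>u_star_pos\<close>).

  All the factors in the definition of $u_n^*$ are nonnegative as soon as the inverses of
  $-{}_{(n)}Q$ and $-{}_{(n-1)}Q$ exist and are nonnegative; $u_n^*(j)$ is then at least the diagonal entry of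
  the first inverse at $(n,j)$, which cannot vanish because off-diagonal entries of $-{}_{(n)}Q$ only
  contribute nonpositive terms to the equation for the diagonal entry 1 of the identity.

  Existence and nonnegativity of the inverse both come from a minimum principle
  (\<open>truncation_minimum_principle\<close>): a function \<open>f\<close> on a finite proper subset \<open>I\<close> of the state
  space with \<open>- Q f \<ge> 0\<close> on \<open>I\<close> is nonnegative. Otherwise the points where \<open>f\<close> attains its negative
  minimum would form a set that the chain cannot leave, against irreducibility. The principle makes
  the truncated matrix injective, hence invertible, and applied to the columns of the
  inverse it gives their nonnegativity.
\<close>

section \<open>Inverses of matrices indexed by a finite set\<close>

text \<open>
  One step of Gaussian elimination removes one equation and one unknown, so the surplus of unknowns
  persists until no equation is left.
\<close>

lemma homogeneous_system_nontrivial_solution: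
  fixes A :: "'r \<Rightarrow> 'c \<Rightarrow> 'a::field"
  assumes "finite R" "finite K" "card R < card K"
  shows "\<exists>f. (\<exists>c\<in>K. f c \<noteq> 0) \<and> (\<forall>r\<in>R. (\<Sum>c\<in>K. A r c * f c) = 0)"
  using assms
proof (induction R arbitrary: K A rule: finite_induct)
  case empty
  then have "K \<noteq> {}" by auto
  then show ?case by (intro exI[of _ "\<lambda>_. 1"]) auto
next
  case (insert r R)
  show ?case
  proof (cases "\<forall>c\<in>K. A r c = 0")
    case True
    have "card R < card K"
      using insert.hyps insert.prems by simp
    from insert.IH[OF insert.prems(1) this, of A] True show ?thesis
      by auto
  next
    case False
    then obtain p where p: "p \<in> K" "A r p \<noteq> 0" by auto
    define A' where "A' x c = A x c - A x p * A r c / A r p" for x c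
    have "card R < card (K - {p})"
      using insert.hyps insert.prems p by simp
    with insert.IH[of "K - {p}" A'] insert.prems(1) obtain f c where
      c: "c \<in> K - {p}" "f c \<noteq> 0" and f: "\<And>x. x \<in> R \<Longrightarrow> (\<Sum>c\<in>K - {p}. A' x c * f c) = 0"
      by auto
    \<comment> \<open>Row \<open>r\<close> determines the value at the pivot column; the other rows have been cleared there.\<close>
    define t where "t = - (\<Sum>c\<in>K - {p}. A r c * f c) / A r p"
    define g where "g = f(p := t)"
    have row: "(\<Sum>c\<in>K. A x c * g c) = A x p * t + (\<Sum>c\<in>K - {p}. A x c * f c)" for x
      using insert.prems(1) p(1) by (subst sum.remove[of K p]) (auto simp: g_def)
    have "(\<Sum>c\<in>K. A x c * g c) = 0" if "x \<in> R" for x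
    proof -
      have "(\<Sum>c\<in>K - {p}. A' x c * f c) =
            (\<Sum>c\<in>K - {p}. A x c * f c) - (\<Sum>c\<in>K - {p}. A x p / A r p * (A r c * f c))"
        unfolding sum_subtractf[symmetric] by (intro sum.cong) (auto simp: A'_def field_simps)
      also have "\<dots> = (\<Sum>c\<in>K - {p}. A x c * f c) + A x p * t"
        by (subst sum_distrib_left[symmetric]) (simp add: t_def)
      finally show ?thesis using f[OF that] row by (simp add: add.commute)
    qed
    moreover have "(\<Sum>c\<in>K. A r c * g c) = 0"
      using p(2) row by (simp add: t_def)
    moreover have "c \<in> K" "g c \<noteq> 0"
      using c by (auto simp: g_def)
    ultimately show ?thesis by blast
  qed
qed

text \<open>
  Adjoining the right-hand side \<open>g\<close> as an additional column gives more unknowns than equations, and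
  injectivity forces the unknown belonging to \<open>g\<close> to be nonzero.
\<close>

lemma injective_system_solvable:
  fixes A :: "'i \<Rightarrow> 'i \<Rightarrow> 'a::field"
  assumes "finite I"
    and inj: "\<And>f. (\<And>x. x \<in> I \<Longrightarrow> (\<Sum>z\<in>I. A x z * f z) = 0) \<Longrightarrow> (\<And>z. z \<in> I \<Longrightarrow> f z = 0)"
  shows "\<exists>f. \<forall>x\<in>I. (\<Sum>z\<in>I. A x z * f z) = g x"
proof -
  define K where "K = insert None (Some ` I)"
  define A' where "A' x c = (case c of None \<Rightarrow> g x | Some z \<Rightarrow> A x z)" for x c
  have "finite K" "card I < card K"
    using assms(1) by (auto simp: K_def card_image)
  then obtain h c where c: "c \<in> K" "h c \<noteq> 0"
    and h: "\<And>x. x \<in> I \<Longrightarrow> (\<Sum>c\<in>K. A' x c * h c) = 0"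
    using homogeneous_system_nontrivial_solution[OF assms(1), of K A'] by auto
  have eq: "g x * h None + (\<Sum>z\<in>I. A x z * h (Some z)) = 0" if "x \<in> I" for x
    using h[OF that] assms(1) by (simp add: K_def A'_def sum.reindex)
  have "h None \<noteq> 0"
  proof
    assume "h None = 0"
    with inj[of "\<lambda>z. h (Some z)"] eq have "\<And>z. z \<in> I \<Longrightarrow> h (Some z) = 0" by simp
    with c \<open>h None = 0\<close> show False by (auto simp: K_def)
  qed
  have "(\<Sum>z\<in>I. A x z * (- h (Some z) / h None)) = g x" if "x \<in> I" for x
  proof -
    have "(\<Sum>z\<in>I. A x z * (- h (Some z) / h None)) = - (\<Sum>z\<in>I. A x z * h (Some z)) / h None"
      by (simp add: sum_divide_distrib sum_negf)
    also have "\<dots> = g x"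
      using eq[OF that] \<open>h None \<noteq> 0\<close> by (simp add: field_simps) (metis add.commute eq_neg_iff_add_eq_0 minus_minus)
    finally show ?thesis .
  qed
  then show ?thesis by (intro exI[of _ "\<lambda>z. - h (Some z) / h None"]) blast
qed

text \<open>
  As \<^const>\<open>inverse_on\<close> is a definite description, it has the defining property of an inverse only
  once a two-sided inverse is known to exist and to be unique. Injectivity of the matrix gives
  solvability, hence a right inverse, and it also makes this right inverse two-sided and unique.
\<close>

lemma inverse_on_right_inverse:
  fixes A :: "'i \<Rightarrow> 'i \<Rightarrow> real"
  assumes "finite I"
    and inj: "\<And>f. (\<And>x. x \<in> I \<Longrightarrow> (\<Sum>z\<in>I. A x z * f z) = 0) \<Longrightarrow> (\<And>z. z \<in> I \<Longrightarrow> f z = 0)"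
    and "x \<in> I" "y \<in> I"
  shows "(\<Sum>z\<in>I. A x z * inverse_on I A z y) = of_bool (x = y)"
proof -
  define is_inv where "is_inv B \<longleftrightarrow>
    (\<forall>x\<in>I. \<forall>y\<in>I. (\<Sum>z\<in>I. A x z * B z y) = of_bool (x = y)) \<and>
    (\<forall>x\<in>I. \<forall>y\<in>I. (\<Sum>z\<in>I. B x z * A z y) = of_bool (x = y)) \<and>
    (\<forall>x y. x \<notin> I \<or> y \<notin> I \<longrightarrow> B x y = 0)" for B
  have "\<exists>f. \<forall>x\<in>I. (\<Sum>z\<in>I. A x z * f z) = of_bool (x = y)" for y
    using assms(1) inj by (rule injective_system_solvable)
  then obtain F where F: "\<And>x y. x \<in> I \<Longrightarrow> (\<Sum>z\<in>I. A x z * F y z) = of_bool (x = y)"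
    by metis
  define B where "B z y = (if z \<in> I \<and> y \<in> I then F y z else 0)" for z y
  have right: "(\<Sum>z\<in>I. A x z * B z y) = of_bool (x = y)" if "x \<in> I" "y \<in> I" for x y
    using F[OF that(1), of y] that by (simp add: B_def)
  have left: "(\<Sum>z\<in>I. B x z * A z y) = of_bool (x = y)" if "x \<in> I" "y \<in> I" for x y
  proof -
    \<comment> \<open>\<open>A (B A - 1) = (A B) A - A = 0\<close>, so the columns of \<open>B A - 1\<close> vanish by injectivity.\<close>
    have "(\<Sum>w\<in>I. A x w * ((\<Sum>z\<in>I. B w z * A z y) - of_bool (w = y))) = 0" if "x \<in> I" for x
    proof -
      have "(\<Sum>w\<in>I. A x w * (\<Sum>z\<in>I. B w z * A z y)) = (\<Sum>w\<in>I. \<Sum>z\<in>I. A x w * B w z * A z y)"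
        by (simp add: sum_distrib_left mult.assoc)
      also have "\<dots> = (\<Sum>z\<in>I. (\<Sum>w\<in>I. A x w * B w z) * A z y)"
        by (subst sum.swap) (simp add: sum_distrib_right)
      also have "\<dots> = (\<Sum>z\<in>I. of_bool (x = z) * A z y)"
        using right that by simp
      also have "\<dots> = A x y"
        using assms(1) that by (simp add: of_bool_def if_distrib[of "\<lambda>t. t * _"] cong: if_cong)
      finally have 1: "(\<Sum>w\<in>I. A x w * (\<Sum>z\<in>I. B w z * A z y)) = A x y" .
      have "(\<Sum>w\<in>I. A x w * of_bool (w = y)) = A x y"
        using assms(1) \<open>y \<in> I\<close> by (simp add: of_bool_def if_distrib[of "\<lambda>t. _ * t"] cong: if_cong)
      with 1 show ?thesis by (simp add: right_diff_distrib sum_subtractf)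
    qed
    from inj[OF this \<open>x \<in> I\<close>] show ?thesis by simp
  qed
  have "is_inv B"
    using right left by (auto simp: is_inv_def B_def)
  moreover have "B' = B" if "is_inv B'" for B'
  proof (intro ext)
    fix z y
    show "B' z y = B z y"
    proof (cases "z \<in> I \<and> y \<in> I")
      case True
      have "(\<Sum>z\<in>I. A x z * (B' z y - B z y)) = 0" if "x \<in> I" for x
        using right[of x y] \<open>is_inv B'\<close> that True
        by (simp add: is_inv_def right_diff_distrib sum_subtractf)
      from inj[OF this, of z] True show ?thesis by simp
    next
      case False
      with that show ?thesis by (auto simp: is_inv_def B_def)
    qed
  qed
  ultimately have "is_inv (THE B. is_inv B)"
    by (rule theI)
  then show ?thesis
    using assms(3,4) unfolding is_inv_def inverse_on_def by blast
qed

section \<open>Truncations of an irreducible conservative generator\<close>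

lemma generator_partial_row_sum_nonpos:
  assumes "conservative_generator S Q" "finite F" "F \<subseteq> S" "x \<in> F"
  shows "(\<Sum>y\<in>F. Q x y) \<le> 0"
proof -
  have "(Q x has_sum 0) S" "(Q x has_sum (\<Sum>y\<in>F. Q x y)) F"
    using assms by (auto simp: conservative_generator_def)
  then have "(Q x has_sum (0 - (\<Sum>y\<in>F. Q x y))) (S - F)"
    using assms(3) by (intro has_sum_Diff)
  moreover have "Q x y \<ge> 0" if "y \<in> S - F" for y
    using that assms by (auto simp: conservative_generator_def)
  ultimately have "0 - (\<Sum>y\<in>F. Q x y) \<ge> 0"
    by (rule has_sum_nonneg)
  then show ?thesis by simp
qed

text \<open>
  At a point \<open>x\<close> where \<open>f\<close> attains a negative minimum \<open>m\<close>, the value \<open>(Q f) x\<close> is the sum of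
  \<open>Q x z * (f z - m)\<close> over \<open>z\<close> and of \<open>m\<close> times the truncated row sum. Both parts are nonnegative, so
  they vanish when \<open>(Q f) x \<le> 0\<close>. Thus \<open>Q\<close> allows no transition from \<open>x\<close> to a point of \<open>I\<close> with a
  larger value, nor to a point outside \<open>I\<close>.
\<close>

lemma truncation_minimum_principle:
  assumes gen: "conservative_generator S Q" and irr: "irreducible_generator S Q"
    and I: "finite I" "I \<subset> S"
    and f: "\<And>x. x \<in> I \<Longrightarrow> (\<Sum>z\<in>I. - Q x z * f z) \<ge> 0"
    and "z \<in> I"
  shows "f z \<ge> 0"
proof (rule ccontr)
  assume "\<not> f z \<ge> 0"
  define m where "m = Min (f ` I)"
  have m_le: "m \<le> f x" if "x \<in> I" for x
    using that I by (simp add: m_def)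
  have "m < 0"
    using m_le[OF \<open>z \<in> I\<close>] \<open>\<not> f z \<ge> 0\<close> by simp
  have "m \<in> f ` I"
    unfolding m_def using I \<open>z \<in> I\<close> by (intro Min_in) auto
  then obtain x0 where x0: "x0 \<in> I" "f x0 = m" by auto
  obtain s where s: "s \<in> S" "s \<notin> I"
    using I by auto
  have closed: "y \<in> I \<and> f y = m"
    if x: "x \<in> I" "f x = m" and y: "y \<in> S" "x \<noteq> y" "Q x y > 0" for x y
  proof -
    have off: "Q x w * (f w - m) \<ge> 0" if "w \<in> I" for w
    proof (cases "w = x")
      case False
      have "x \<in> S" "w \<in> S"
        using that x I by auto
      with False have "Q x w \<ge> 0"
        using gen by (simp add: conservative_generator_def)
      with m_le[OF that] show ?thesis by simp
    qed (use x in simp)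
    have row: "(\<Sum>w\<in>I. Q x w) \<le> 0"
      using generator_partial_row_sum_nonpos[OF gen] I x by auto
    have "(\<Sum>w\<in>I. Q x w * (f w - m)) + m * (\<Sum>w\<in>I. Q x w) = (\<Sum>w\<in>I. Q x w * f w)"
      by (simp add: right_diff_distrib sum_subtractf sum_distrib_left mult.commute)
    also have "\<dots> \<le> 0"
      using f[OF x(1)] by (simp add: sum_negf)
    finally have le: "(\<Sum>w\<in>I. Q x w * (f w - m)) + m * (\<Sum>w\<in>I. Q x w) \<le> 0" .
    have nonneg: "(\<Sum>w\<in>I. Q x w * (f w - m)) \<ge> 0" "m * (\<Sum>w\<in>I. Q x w) \<ge> 0"
      using off row \<open>m < 0\<close> by (auto intro: sum_nonneg mult_nonpos_nonpos)
    with le have "(\<Sum>w\<in>I. Q x w * (f w - m)) = 0" "m * (\<Sum>w\<in>I. Q x w) = 0"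
      by linarith+
    then have zero: "\<And>w. w \<in> I \<Longrightarrow> Q x w * (f w - m) = 0" "(\<Sum>w\<in>I. Q x w) = 0"
      using off I(1) \<open>m < 0\<close> by (auto simp: sum_nonneg_eq_0_iff)
    have "y \<in> I"
    proof (rule ccontr)
      assume "y \<notin> I"
      then have "Q x y + (\<Sum>w\<in>I. Q x w) \<le> 0"
        using generator_partial_row_sum_nonpos[OF gen, of "insert y I" x] I x y by auto
      with zero(2) y show False by simp
    qed
    with zero(1)[of y] y show ?thesis by auto
  qed
  have "(x0, s) \<in> {(a, b). a \<in> S \<and> b \<in> S \<and> a \<noteq> b \<and> Q a b > 0}\<^sup>*"
    using irr x0 s I by (auto simp: irreducible_generator_def)
  then have "s \<in> I \<and> f s = m"
  proof (induction rule: rtrancl_induct)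
    case base
    show ?case using x0 by simp
  next
    case (step y z)
    then show ?case using closed[of y z] by simp
  qed
  with s show False by simp
qed

lemma truncation_inverse:
  assumes gen: "conservative_generator S Q" and irr: "irreducible_generator S Q"
    and I: "finite I" "I \<subset> S" and "x \<in> I" "y \<in> I"
  shows "(\<Sum>z\<in>I. - Q x z * inverse_on I (\<lambda>x y. - Q x y) z y) = of_bool (x = y)"
proof (rule inverse_on_right_inverse[OF I(1) _ \<open>x \<in> I\<close> \<open>y \<in> I\<close>])
  fix f z
  assume f: "\<And>x. x \<in> I \<Longrightarrow> (\<Sum>z\<in>I. - Q x z * f z) = 0" and "z \<in> I"
  have "f z \<ge> 0"
    by (rule truncation_minimum_principle[OF gen irr I _ \<open>z \<in> I\<close>, where f = f]) (simp only: f order.refl)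
  moreover have "- f z \<ge> 0"
    by (rule truncation_minimum_principle[OF gen irr I _ \<open>z \<in> I\<close>, where f = "\<lambda>z. - f z"])
       (use f in \<open>simp add: sum_negf\<close>)
  ultimately show "f z = 0" by simp
qed

lemma truncation_inverse_nonneg:
  assumes gen: "conservative_generator S Q" and irr: "irreducible_generator S Q"
    and I: "finite I" "I \<subset> S" and "x \<in> I" "y \<in> I"
  shows "inverse_on I (\<lambda>x y. - Q x y) x y \<ge> 0"
proof (rule truncation_minimum_principle[OF gen irr I _ \<open>x \<in> I\<close>,
          where f = "\<lambda>x. inverse_on I (\<lambda>x y. - Q x y) x y"])
  fix w
  assume "w \<in> I"
  from truncation_inverse[OF gen irr I this \<open>y \<in> I\<close>]
  show "(\<Sum>z\<in>I. - Q w z * inverse_on I (\<lambda>x y. - Q x y) z y) \<ge> 0"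
    by simp
qed

lemma truncation_inverse_diag_pos:
  assumes gen: "conservative_generator S Q" and irr: "irreducible_generator S Q"
    and I: "finite I" "I \<subset> S" and "x \<in> I"
  shows "inverse_on I (\<lambda>x y. - Q x y) x x > 0"
proof -
  let ?B = "inverse_on I (\<lambda>x y. - Q x y)"
  have nonneg: "?B z x \<ge> 0" if "z \<in> I" for z
    using truncation_inverse_nonneg[OF gen irr I that \<open>x \<in> I\<close>] .
  have "(\<Sum>z\<in>I - {x}. - Q x z * ?B z x) \<le> 0"
  proof (rule sum_nonpos)
    fix z assume "z \<in> I - {x}"
    then have "x \<in> S" "z \<in> S" "z \<noteq> x" "?B z x \<ge> 0"
      using I \<open>x \<in> I\<close> nonneg by auto
    moreover from this have "Q x z \<ge> 0"
      using gen by (simp add: conservative_generator_def)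
    ultimately
    show "- Q x z * ?B z x \<le> 0" by simp
  qed
  moreover have "- Q x x * ?B x x + (\<Sum>z\<in>I - {x}. - Q x z * ?B z x) = 1"
    using truncation_inverse[OF gen irr I \<open>x \<in> I\<close> \<open>x \<in> I\<close>] I(1) \<open>x \<in> I\<close>
    by (simp add: sum.remove)
  ultimately have "?B x x \<noteq> 0" by auto
  with nonneg[OF \<open>x \<in> I\<close>] show ?thesis by simp
qed

section \<open>Positivity of the denominator\<close>

lemma states_upto_finite_proper:
  assumes "\<And>k. M k \<ge> 1"
  shows "finite (states_upto M n)" "states_upto M n \<subset> states M"
proof -
  have "(Suc n, 1) \<in> states M" "(Suc n, 1) \<notin> states_upto M n"
    using assms by (auto simp: states_def states_upto_def level_def)
  moreover have "states_upto M n \<subseteq> states M"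
    by (auto simp: states_def states_upto_def)
  ultimately show "states_upto M n \<subset> states M" by blast
qed (auto simp: states_upto_def level_def)

lemma trunc_X_nonneg:
  assumes M: "\<And>k. M k \<ge> 1" and gen: "conservative_generator (states M) Q"
    and irr: "irreducible_generator (states M) Q"
    and "x \<in> states_upto M n" "y \<in> states_upto M n"
  shows "trunc_X M Q n x y \<ge> 0"
  unfolding trunc_X_def
  using truncation_inverse_nonneg[OF gen irr states_upto_finite_proper[OF M]] assms(4,5) .

lemma trunc_X_diag_pos:
  assumes M: "\<And>k. M k \<ge> 1" and gen: "conservative_generator (states M) Q"
    and irr: "irreducible_generator (states M) Q"
    and "x \<in> states_upto M n"
  shows "trunc_X M Q n x x > 0"
  unfolding trunc_X_def
  using truncation_inverse_diag_pos[OF gen irr states_upto_finite_proper[OF M]] assms(4) .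

lemma U_nonneg:
  assumes M: "\<And>k. M k \<ge> 1" and gen: "conservative_generator (states M) Q"
    and irr: "irreducible_generator (states M) Q"
    and "k \<le> n" "i \<in> {1..M n}" "j \<in> {1..M k}"
  shows "U M Q n k i j \<ge> 0"
proof (cases "k = n")
  case False
  have "Q (n, i) (n - 1, m) * trunc_X M Q (n - 1) (n - 1, m) (k, j) \<ge> 0"
    if "m \<in> {1..M (n - 1)}" for m
  proof (rule mult_nonneg_nonneg)
    show "Q (n, i) (n - 1, m) \<ge> 0"
    proof -
      have "(n, i) \<in> states M" "(n - 1, m) \<in> states M" "(n, i) \<noteq> (n - 1, m)"
        using that assms(4,5) False by (auto simp: states_def level_def)
      then show ?thesis
        using gen unfolding conservative_generator_def by blast
    qed
    show "trunc_X M Q (n - 1) (n - 1, m) (k, j) \<ge> 0"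
      using that assms False
      by (intro trunc_X_nonneg[OF M gen irr]) (auto simp: states_upto_def level_def)
  qed
  then show ?thesis
    using False by (auto simp: U_def intro: sum_nonneg)
qed (simp add: U_def)

text \<open>
  All terms being nonnegative, a single one bounds the sum from below: the entry \<open>(j, j)\<close> of
  $U_{n,n}^* = U_n^*$.
\<close>

lemma u_star_pos:
  assumes M: "\<And>k. M k \<ge> 1" and gen: "conservative_generator (states M) Q"
    and irr: "irreducible_generator (states M) Q"
    and j: "j \<in> {1..M n}"
  shows "u_star M Q n j > 0"
proof -
  have diag: "U_diag_star M Q n j m \<ge> 0" if "m \<in> {1..M n}" for m
    unfolding U_diag_star_def using that j
    by (intro trunc_X_nonneg[OF M gen irr]) (auto simp: states_upto_def level_def)
  have nonneg: "U_star M Q n k j m \<ge> 0" if "k \<le> n" "m \<in> {1..M k}" for k m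
    unfolding U_star_def
    by (intro sum_nonneg mult_nonneg_nonneg diag U_nonneg[OF M gen irr that(1) _ that(2)])
  have "0 < U_diag_star M Q n j j"
    unfolding U_diag_star_def using j
    by (intro trunc_X_diag_pos[OF M gen irr]) (auto simp: states_upto_def level_def)
  also have "\<dots> = U_star M Q n n j j"
    using j by (simp add: U_star_def U_def of_bool_def if_distrib[of "\<lambda>t. _ * t"] cong: if_cong)
  also have "\<dots> \<le> (\<Sum>m\<in>{1..M n}. U_star M Q n n j m)"
    using nonneg j by (intro member_le_sum) auto
  also have "\<dots> \<le> u_star M Q n j"
    unfolding u_star_def using nonneg
    by (intro member_le_sum[of n "{..n}" "\<lambda>l. \<Sum>m\<in>{1..M l}. U_star M Q n l j m"])
       (auto intro!: sum_nonneg)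
  finally show ?thesis .
qed

section \<open>Linear fractional programming over the simplex\<close>

lemma point_mass_minimises_ratio:
  fixes y u \<alpha> :: "'i \<Rightarrow> real"
  assumes "finite J" and u: "\<And>j. j \<in> J \<Longrightarrow> u j > 0"
    and min: "\<And>j. j \<in> J \<Longrightarrow> \<rho> \<le> y j / u j"
    and \<alpha>: "\<And>j. j \<in> J \<Longrightarrow> \<alpha> j \<ge> 0" "(\<Sum>j\<in>J. \<alpha> j) = 1"
  shows "\<rho> \<le> (\<Sum>j\<in>J. \<alpha> j * y j) / (\<Sum>j\<in>J. \<alpha> j * u j)"
proof -
  have "\<exists>j\<in>J. \<alpha> j \<noteq> 0"
    using \<alpha>(2) by (metis sum.neutral zero_neq_one)
  then obtain i where "i \<in> J" "\<alpha> i > 0"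
    using \<alpha>(1) by force
  then have "(\<Sum>j\<in>J. \<alpha> j * u j) > 0"
    using assms(1) u \<alpha>(1) by (intro sum_pos2[of J i]) (auto simp: less_imp_le)
  moreover have "\<rho> * (\<Sum>j\<in>J. \<alpha> j * u j) \<le> (\<Sum>j\<in>J. \<alpha> j * y j)"
    unfolding sum_distrib_left
  proof (rule sum_mono)
    fix j assume j: "j \<in> J"
    have "\<rho> * u j \<le> y j"
      using min[OF j] u[OF j] by (simp add: field_simps)
    from mult_left_mono[OF this \<alpha>(1)[OF j]] show "\<rho> * (\<alpha> j * u j) \<le> \<alpha> j * y j"
      by (simp add: algebra_simps)
  qed
  ultimately show ?thesis
    by (simp add: field_simps)
qed

theorem theorem3p1:
  fixes M :: "nat \<Rightarrow> nat"
    and Q :: "state \<Rightarrow> state \<Rightarrow> real"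
    and P :: "state \<Rightarrow> 'w measure"
    and X :: "real \<Rightarrow> 'w \<Rightarrow> state"
    and b :: real
    and C :: "state set"
    and v :: "state \<Rightarrow> real"
    and n j_star :: nat
  assumes "\<And>k. M k \<ge> 1"
    and "conservative_generator (states M) Q"
    and "regular_jump_chain (states M) P X"
    and "generator_of (states M) Q P X"
    and "ergodic_chain (states M) Q P X"
    and "upper_block_Hessenberg M Q"
    and "drift_condition (states M) Q b C v"
    and "is_arg_min (\<lambda>j. y_vec M Q v n j / u_star M Q n j) (\<lambda>j. j \<in> {1..M n}) j_star"
  shows "is_arg_min (r_obj M Q v n) (prob_vector M n) (\<lambda>j. if j = j_star then 1 else 0)"
proof -
  let ?\<delta> = "\<lambda>j. if j = j_star then 1 else (0::real)"
  have irr: "irreducible_generator (states M) Q"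
    using assms(5) by (simp add: ergodic_chain_def)
  have star: "j_star \<in> {1..M n}"
    and min: "\<And>j. j \<in> {1..M n} \<Longrightarrow>
      y_vec M Q v n j_star / u_star M Q n j_star \<le> y_vec M Q v n j / u_star M Q n j"
    using assms(8) by (auto simp: is_arg_min_linorder)
  have at_star: "(\<Sum>j\<in>{1..M n}. ?\<delta> j * g j) = g j_star" for g
    using star by (simp add: if_distrib[of "\<lambda>t. t * _"] cong: if_cong)
  have "prob_vector M n ?\<delta>"
    using at_star[of "\<lambda>_. 1"] by (simp add: prob_vector_def)
  moreover have "r_obj M Q v n ?\<delta> \<le> r_obj M Q v n \<alpha>" if "prob_vector M n \<alpha>" for \<alpha>
    unfolding r_obj_def at_star
    using that min u_star_pos[OF assms(1,2) irr]
    by (intro point_mass_minimises_ratio) (auto simp: prob_vector_def)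
  ultimately show ?thesis
    by (simp add: is_arg_min_linorder)
qed

end
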